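(* Let $(X_n,\mathcal{H}_n)_{n\ge 0}$ be the earthworm process on $\mathbb{Z}^2$ and let $S_n=|\mathcal{H}_n|$ be the number of holes at time $n$. For every $\varepsilon>0$ there exists $\delta>0$ such that $$\liminf_{n\to\infty}\mathbb{P}\left(S_n \geq \delta n^{3/4}\right) \geq 1-\varepsilon.$$
   Context: The earthworm process $(X_n,\mathcal{H}_n)_{n\ge 0}$ is defined as follows. $X_n$ is the simple (nearest-neighbour, symmetric) random walk on $\mathbb{Z}^2$ with $X_0=(0,0)$, and $\mathcal{H}_n\subset\mathbb{Z}^2$ is a random finite set (the set of holes at time $n$; all other sites are filled with soil), with $\mathcal{H}_0=\{(0,0)\}$. Given $X_n$, $\mathcal{H}_n$ and the step $e=X_{n+1}-X_n\in\{(1,0),(-1,0),(0,1),(0,-1)\}$, let $R_n=\{X_n+ae: a\in\mathbb{Z}, a\ge 1\}$ be the open ray from $X_n$ in the direction of the step. If $R_n\cap\mathcal{H}_n=\emptyset$, then $\mathcal{H}_{n+1}=\mathcal{H}_n\cup\{X_{n+1}\}$. If $R_n\cap\mathcal{H}_n\ne\emptyset$, let $z_*=X_n+a_*e$ be the element of $R_n\cap\mathcal{H}_n$ with the smallest $a_*\geq 1$, and set $\mathcal{H}_{n+1}=(\mathcal{H}_n\setminus\{z_*\})\cup\{X_{n+1}\}$ (so if $X_{n+1}$ is already a hole then $\mathcal{H}_{n+1}=\mathcal{H}_n$). The total number of holes at time $n$ is $S_n=|\mathcal{H}_n|$. *)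

theory Defs
  imports "HOL-Probability.Probability"
begin

definition unit_steps :: "(int \<times> int) set" where
  "unit_steps = {(1, 0), (-1, 0), (0, 1), (0, -1)}"

definition ray_site :: "int \<times> int \<Rightarrow> int \<times> int \<Rightarrow> nat \<Rightarrow> int \<times> int" where
  "ray_site x e a = (fst x + int a * fst e, snd x + int a * snd e)"

definition open_ray :: "int \<times> int \<Rightarrow> int \<times> int \<Rightarrow> (int \<times> int) set" where
  "open_ray x e = {ray_site x e a | a. a \<ge> 1}"

definition first_hole :: "int \<times> int \<Rightarrow> int \<times> int \<Rightarrow> (int \<times> int) set \<Rightarrow> int \<times> int" where
  "first_hole x e A = ray_site x e (LEAST a. a \<ge> 1 \<and> ray_site x e a \<in> A)"

definition update_holes ::
    "int \<times> int \<Rightarrow> int \<times> int \<Rightarrow> (int \<times> int) set \<Rightarrow> (int \<times> int) set" where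
  "update_holes x e A =
     (if open_ray x e \<inter> A = {} then A \<union> {x + e}
      else (A - {first_hole x e A}) \<union> {x + e})"

text \<open>
  The process may live on any probability space. The increments of the walk lie in
  \<^const>\<open>unit_steps\<close> only almost surely; on the exceptional null set the update rule is
  applied to whatever increment occurs.
\<close>

locale earthworm_process = prob_space M for M :: "'w measure" +
  fixes X :: "nat \<Rightarrow> 'w \<Rightarrow> int \<times> int"
    and H :: "nat \<Rightarrow> 'w \<Rightarrow> (int \<times> int) set"
  assumes walk_start: "\<And>\<omega>. \<omega> \<in> space M \<Longrightarrow> X 0 \<omega> = (0, 0)"
    and steps_indep:
      "indep_vars (\<lambda>_. count_space UNIV) (\<lambda>n \<omega>. X (Suc n) \<omega> - X n \<omega>) UNIV"
    and steps_uniform: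
      "\<And>n. distr M (count_space UNIV) (\<lambda>\<omega>. X (Suc n) \<omega> - X n \<omega>)
            = measure_pmf (pmf_of_set unit_steps)"
    and holes_start: "\<And>\<omega>. \<omega> \<in> space M \<Longrightarrow> H 0 \<omega> = {(0, 0)}"
    and holes_step:
      "\<And>n \<omega>. \<omega> \<in> space M \<Longrightarrow>
         H (Suc n) \<omega> = update_holes (X n \<omega>) (X (Suc n) \<omega> - X n \<omega>) (H n \<omega>)"

definition num_holes :: "(nat \<Rightarrow> 'w \<Rightarrow> (int \<times> int) set) \<Rightarrow> nat \<Rightarrow> 'w \<Rightarrow> nat" where
  "num_holes H n \<omega> = card (H n \<omega>)"

end

theory Submission
  imports Defs "HOL-Real_Asymp.Real_Asymp"
begin

text \<open>
  Every hole is a visited site, so a step to the right from a site that is rightmost among the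
  visited sites of its row creates a hole. A walk that stands at such a site next returns to a
  rightmost site of the same row when it hits the half-line on its right, and it avoids that
  half-line up to time \<open>t\<close> with probability of order at most \<open>t\<close> to the power \<open>-1/4\<close>. A row
  at height at most \<open>\<eta> sqrt n\<close> is typically reached early, after which the gaps between its rightmost
  visits must fill a time of order \<open>n\<close>; hence with high probability there are at least of order
  \<open>n\<close> to the power \<open>1/4\<close> of them. By Markov's
  inequality most of the \<open>\<eta> sqrt n\<close> rows are of this kind, and by a martingale second
  moment bound about a quarter of all rightmost visits are followed by a step to the right.
\<close>

section \<open>Averages over finite paths\<close>

text \<open>A path is the list of its increments, so the walk at time \<open>i\<close> is
  \<open>sum_list (take i xs)\<close>. Probabilities of the first \<open>n\<close> steps become
  counts over \<open>4 ^ n\<close> lists; the measure \<open>M\<close> enters only at the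
  end.\<close>

definition paths :: "nat \<Rightarrow> (int \<times> int) list set" where
  "paths n = {xs. set xs \<subseteq> unit_steps \<and> length xs = n}"

definition avg :: "nat \<Rightarrow> ((int \<times> int) list \<Rightarrow> real) \<Rightarrow> real" where
  "avg n f = (\<Sum>xs\<in>paths n. f xs) / 4 ^ n"

abbreviation pr :: "nat \<Rightarrow> ((int \<times> int) list \<Rightarrow> bool) \<Rightarrow> real" where
  "pr n P \<equiv> avg n (\<lambda>xs. of_bool (P xs))"

lemma finite_unit_steps [simp]: "finite unit_steps"
  and card_unit_steps [simp]: "card unit_steps = 4"
  by (simp_all add: unit_steps_def)

lemma finite_paths [simp]: "finite (paths n)"
  by (simp add: paths_def finite_lists_length_eq)

lemma card_paths [simp]: "card (paths n) = 4 ^ n"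
  by (simp add: paths_def card_lists_length_eq)

lemma length_paths: "xs \<in> paths n \<Longrightarrow> length xs = n"
  by (simp add: paths_def)

lemma avg_const [simp]: "avg n (\<lambda>_. c) = c"
  by (simp add: avg_def)

lemma avg_add: "avg n (\<lambda>xs. f xs + g xs) = avg n f + avg n g"
  by (simp add: avg_def sum.distrib add_divide_distrib)

lemma avg_cmult: "avg n (\<lambda>xs. c * f xs) = c * avg n f"
  by (simp add: avg_def sum_distrib_left)

lemma avg_sum: "avg n (\<lambda>xs. \<Sum>i\<in>I. f i xs) = (\<Sum>i\<in>I. avg n (f i))"
  unfolding avg_def by (subst sum.swap) (simp add: sum_divide_distrib)

lemma avg_cong: "(\<And>xs. xs \<in> paths n \<Longrightarrow> f xs = g xs) \<Longrightarrow> avg n f = avg n g"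
  by (simp add: avg_def)

lemma avg_mono: "(\<And>xs. xs \<in> paths n \<Longrightarrow> f xs \<le> g xs) \<Longrightarrow> avg n f \<le> avg n g"
  by (simp add: avg_def divide_right_mono sum_mono)

lemma pr_mono: "(\<And>xs. xs \<in> paths n \<Longrightarrow> P xs \<Longrightarrow> Q xs) \<Longrightarrow> pr n P \<le> pr n Q"
  by (rule avg_mono) auto

lemma avg_nonneg: "(\<And>xs. xs \<in> paths n \<Longrightarrow> 0 \<le> f xs) \<Longrightarrow> 0 \<le> avg n f"
  by (simp add: avg_def sum_nonneg)

lemma pr_nonneg [simp]: "0 \<le> pr n P"
  by (rule avg_nonneg) auto

lemma pr_disj_le: "pr n (\<lambda>xs. P xs \<or> Q xs) \<le> pr n P + pr n Q"
  unfolding avg_add[symmetric] by (rule avg_mono) auto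

lemma pr_not: "pr n (\<lambda>xs. \<not> P xs) = 1 - pr n P"
proof -
  have "pr n P + pr n (\<lambda>xs. \<not> P xs) = avg n (\<lambda>_. 1)"
    unfolding avg_add[symmetric] by (rule avg_cong) auto
  then show ?thesis by simp
qed

lemma pr_markov:
  assumes "c > 0" "\<And>xs. xs \<in> paths n \<Longrightarrow> 0 \<le> f xs"
  shows "c * pr n (\<lambda>xs. c \<le> f xs) \<le> avg n f"
  unfolding avg_cmult[symmetric] by (rule avg_mono) (use assms in auto)

text \<open>Independence of the first \<open>m\<close> steps from the rest: concatenation is a
  bijection from pairs of paths to paths.\<close>

lemma avg_split:
  "avg (m + n) (\<lambda>xs. f (take m xs) * g (drop m xs)) = avg m f * avg n g"
proof -
  have bij: "bij_betw (\<lambda>(us, vs). us @ vs) (paths m \<times> paths n) (paths (m + n))"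
    by (rule bij_betw_byWitness[where f' = "\<lambda>xs. (take m xs, drop m xs)"])
       (auto simp: paths_def dest: in_set_takeD in_set_dropD)
  have "(\<Sum>xs\<in>paths (m + n). f (take m xs) * g (drop m xs))
      = (\<Sum>(us, vs)\<in>paths m \<times> paths n. f us * g vs)"
    by (subst sum.reindex_bij_betw[OF bij, symmetric])
       (auto intro!: sum.cong simp: length_paths)
  also have "\<dots> = (\<Sum>us\<in>paths m. f us) * (\<Sum>vs\<in>paths n. g vs)"
    by (simp add: sum_product sum.cartesian_product)
  finally show ?thesis by (simp add: avg_def power_add)
qed

lemma avg_take:
  assumes "m \<le> n" shows "avg n (\<lambda>xs. f (take m xs)) = avg m f"
  using avg_split[of m "n - m" f "\<lambda>_. 1"] assms by simp

text \<open>Conditioning on all steps but the last; the second moment of the martingale is bounded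
  by induction along it.\<close>

lemma avg_Suc: "avg (Suc n) f = avg n (\<lambda>xs. (\<Sum>e\<in>unit_steps. f (xs @ [e])) / 4)"
proof -
  have bij: "bij_betw (\<lambda>(us, e). us @ [e]) (paths n \<times> unit_steps) (paths (Suc n))"
  proof (rule bij_betw_byWitness[where f' = "\<lambda>xs. (butlast xs, last xs)"])
    have "xs \<noteq> []" if "xs \<in> paths (Suc n)" for xs
      using that by (auto simp: paths_def)
    moreover have "last xs \<in> unit_steps" if "xs \<in> paths (Suc n)" for xs
      using that last_in_set[of xs] by (cases "xs = []") (auto simp only: paths_def mem_Collect_eq list.size)
    ultimately show "\<forall>xs\<in>paths (Suc n). (\<lambda>(us, e). us @ [e]) (butlast xs, last xs) = xs"
      "(\<lambda>xs. (butlast xs, last xs)) ` paths (Suc n) \<subseteq> paths n \<times> unit_steps"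
      by (auto simp: paths_def dest: in_set_butlastD)
  qed (auto simp: paths_def)
  have "(\<Sum>xs\<in>paths (Suc n). f xs) = (\<Sum>us\<in>paths n. \<Sum>e\<in>unit_steps. f (us @ [e]))"
    by (subst sum.reindex_bij_betw[OF bij, symmetric]) (simp add: sum.cartesian_product split_def)
  then show ?thesis by (simp add: avg_def sum_divide_distrib[symmetric])
qed

lemma avg_0: "avg 0 f = f []"
proof -
  have "paths 0 = {[]}" by (auto simp: paths_def)
  then show ?thesis by (simp add: avg_def)
qed

text \<open>Time reversal: reversing the order and the signs of the increments is an involution of
  \<open>paths n\<close>. It turns a condition on the positions before a given time into an
  avoidance condition on a path that starts there.\<close>

lemma avg_flip: "avg n (\<lambda>xs. f (map uminus (rev xs))) = avg n f"
proof -
  have inv: "map uminus (rev (map uminus (rev xs))) = xs" for xs :: "(int \<times> int) list"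
    by (simp add: rev_map comp_def)
  have "- e \<in> unit_steps" if "e \<in> unit_steps" for e
    using that by (auto simp: unit_steps_def)
  then have "(\<lambda>xs. map uminus (rev xs)) ` paths n \<subseteq> paths n"
    by (fastforce simp: paths_def simp del: uminus_Pair)
  then have "bij_betw (\<lambda>xs. map uminus (rev xs)) (paths n) (paths n)"
    by (intro bij_betw_byWitness[where f' = "\<lambda>xs. map uminus (rev xs)"]) (use inv in blast)+
  then show ?thesis
    unfolding avg_def by (simp add: sum.reindex_bij_betw[of _ _ _ f])
qed

section \<open>Avoiding a half-line\<close>

text \<open>Time 0 is left out because \<open>K\<close> may contain the origin, as the row and the
  half-line do; the event concerns hits after the start.\<close>

definition avoids :: "(int \<times> int) set \<Rightarrow> (int \<times> int) list \<Rightarrow> bool" where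
  "avoids K xs \<longleftrightarrow> (\<forall>i. 0 < i \<and> i \<le> length xs \<longrightarrow> sum_list (take i xs) \<notin> K)"

lemma avoids_take: "avoids K xs \<Longrightarrow> avoids K (take j xs)"
  by (simp add: avoids_def)

lemma pr_avoids_antimono:
  assumes "s \<le> t" shows "pr t (avoids K) \<le> pr s (avoids K)"
  unfolding avg_take[OF assms, symmetric, of "\<lambda>xs. of_bool (avoids K xs)"]
  by (rule pr_mono) (rule avoids_take)

lemma sum_list_drop_diff:
  fixes xs :: "'a::ab_group_add list"
  shows "sum_list (drop j xs) = sum_list xs - sum_list (take j xs)"
  by (metis add_diff_cancel_left' append_take_drop_id sum_list_append)

lemma sum_list_take_drop:
  fixes xs :: "'a::ab_group_add list"
  shows "sum_list (take i (drop j xs)) = sum_list (take (j + i) xs) - sum_list (take j xs)"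
  by (simp add: take_drop sum_list_drop_diff add.commute min_def)

lemma sum_list_map_uminus:
  fixes xs :: "'a::ab_group_add list"
  shows "sum_list (map uminus xs) = - sum_list xs"
  by (induction xs) auto

text \<open>The reflected path retraces the positions backwards, seen from the endpoint.\<close>

lemma sum_list_take_flip:
  fixes xs :: "'a::ab_group_add list"
  assumes "i \<le> length xs"
  shows "sum_list (take i (map uminus (rev xs)))
       = sum_list (take (length xs - i) xs) - sum_list xs"
  using assms
  by (simp add: take_map take_rev sum_list_map_uminus sum_list_rev sum_list_drop_diff)

lemma of_bool_le_sum:
  fixes f :: "'a \<Rightarrow> 'b::linordered_idom"
  assumes "\<And>i. i \<in> I \<Longrightarrow> 0 \<le> f i" "finite I" "P \<Longrightarrow> \<exists>i\<in>I. 1 \<le> f i"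
  shows "of_bool P \<le> sum f I"
proof (cases P)
  case True
  then obtain i where "i \<in> I" "1 \<le> f i" using assms(3) by blast
  with member_le_sum[of i I f] assms(1,2) have "1 \<le> sum f I" by force
  then show ?thesis by simp
qed (simp add: assms(1) sum_nonneg)

text \<open>The index triangle \<open>m + s < n\<close> lies in the square, and all terms are
  nonnegative.\<close>

lemma convolution_le:
  fixes a b :: "nat \<Rightarrow> real"
  assumes "\<And>i. 0 \<le> a i" "\<And>i. 0 \<le> b i"
  shows "(\<Sum>t<n. \<Sum>m\<le>t. a m * b (t - m)) \<le> (\<Sum>m<n. a m) * (\<Sum>s<n. b s)"
proof -
  have "(\<Sum>t<n. \<Sum>m\<le>t. a m * b (t - m)) = (\<Sum>(m, s)\<in>{(m, s). m + s < n}. a m * b s)"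
    by (rule sum.triangle_reindex[symmetric])
  also have "\<dots> \<le> (\<Sum>(m, s)\<in>{..<n} \<times> {..<n}. a m * b s)"
    by (rule sum_mono2) (use assms in auto)
  finally show ?thesis by (simp add: sum_product sum.cartesian_product)
qed

text \<open>At most one time \<open>j\<close> is such that the walk is in \<open>G\<close> at time \<open>j\<close> and \<open>\<phi>\<close> is strictly larger
  there than at all other visits to \<open>G\<close>. The part of the path before \<open>j\<close>, reversed and reflected, and
  the part after \<open>j\<close> are independent paths that avoid \<open>K\<close>.\<close>
lemma unique_max_bound:
  fixes G :: "(int \<times> int) set" and \<phi> :: "int \<times> int \<Rightarrow> int"
  assumes G: "\<And>x y. x \<in> G \<Longrightarrow> y \<in> G \<Longrightarrow> x - y \<in> G"
    and \<phi>: "\<And>x y. \<phi> (x - y) = \<phi> x - \<phi> y"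
    and K: "K = {x \<in> G. 0 \<le> \<phi> x}"
  shows "(\<Sum>j\<le>t. pr j (\<lambda>xs. avoids K xs \<and> sum_list xs \<in> G)) * pr t (avoids K) \<le> 1"
proof -
  define U where "U xs \<longleftrightarrow> avoids K xs \<and> sum_list xs \<in> G" for xs
  define E where "E j xs \<longleftrightarrow> U (map uminus (rev (take j xs))) \<and> avoids K (drop j xs)" for j xs
  have Gm: "x \<in> G \<longleftrightarrow> - x \<in> G" for x
    using G[of 0 x] G[of 0 "- x"] G[of x x] G[of "-x" "-x"] by auto
  have "(\<Sum>j\<le>t. pr j U) * pr t (avoids K) = (\<Sum>j\<le>t. pr j U * pr t (avoids K))"
    by (simp add: sum_distrib_right)
  \<comment> \<open>Shortening the avoidance time to \<open>t - j\<close> only raises the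
    probability, and both factors then fit into one path of length \<open>t\<close>.\<close>
  also have "\<dots> \<le> (\<Sum>j\<le>t. pr j U * pr (t - j) (avoids K))"
    by (intro sum_mono mult_left_mono pr_avoids_antimono) auto
  also have "\<dots> = (\<Sum>j\<le>t. pr t (E j))"
  proof (rule sum.cong[OF refl])
    fix j assume "j \<in> {..t}"
    then have "pr t (E j) = pr j (\<lambda>xs. U (map uminus (rev xs))) * pr (t - j) (avoids K)"
      unfolding E_def of_bool_conj
      using avg_split[of j "t - j" "\<lambda>xs. of_bool (U (map uminus (rev xs)))"
          "\<lambda>xs. of_bool (avoids K xs)"] by simp
    then show "pr j U * pr (t - j) (avoids K) = pr t (E j)"
      using avg_flip[of j "\<lambda>xs. of_bool (U xs)"] by simp
  qed
  also have "\<dots> = avg t (\<lambda>xs. \<Sum>j\<le>t. of_bool (E j xs))"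
    by (rule avg_sum[symmetric])
  also have "\<dots> \<le> avg t (\<lambda>_. 1)"
  proof (rule avg_mono)
    fix xs assume xs: "xs \<in> paths t"
    define S where "S i = sum_list (take i xs)" for i
    have SG: "S j \<in> G" if "E j xs" "j \<le> t" for j
      using that Gm[of "S j"]
      by (auto simp: E_def U_def S_def sum_list_map_uminus rev_map[symmetric] sum_list_rev)
    have before: "S i - S j \<notin> K" if "E j xs" "i < j" "j \<le> t" for i j
    proof -
      have "sum_list (take (j - i) (map uminus (rev (take j xs)))) \<notin> K"
        using that xs by (auto simp: E_def U_def avoids_def length_paths)
      moreover have "length (take j xs) = j" using that xs by (simp add: length_paths)
      ultimately show ?thesis
        using that by (simp add: sum_list_take_flip S_def)
    qed
    have after: "S i - S j \<notin> K" if "E j xs" "j < i" "i \<le> t" for i j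
    proof -
      have "sum_list (take (i - j) (drop j xs)) \<notin> K"
        using that xs by (auto simp: E_def avoids_def length_paths)
      then show ?thesis
        using that by (simp add: sum_list_take_drop S_def)
    qed
    \<comment> \<open>For two such times, the difference of the positions and its negative both lie
      in \<open>G\<close>, and \<open>\<phi>\<close> is nonnegative on one of them, which is
      therefore in \<open>K\<close>.\<close>
    have uniq: "\<not> (E i xs \<and> E j xs)" if "i < j" "j \<le> t" for i j
    proof
      assume E: "E i xs \<and> E j xs"
      have "S i - S j \<notin> K" "S j - S i \<notin> K" "S i \<in> G" "S j \<in> G"
        using before[of j i] after[of i j] SG[of i] SG[of j] E that by auto
      then show False using G[of "S i" "S j"] G[of "S j" "S i"]
        by (auto simp: K \<phi>)
    qed
    have "card {j. j \<le> t \<and> E j xs} \<le> Suc 0"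
    proof (subst card_le_Suc0_iff_eq)
      show "\<forall>i\<in>{j. j \<le> t \<and> E j xs}. \<forall>j\<in>{j. j \<le> t \<and> E j xs}. i = j"
        using uniq by (metis (mono_tags, lifting) linorder_neqE_nat mem_Collect_eq)
    qed simp
    then show "(\<Sum>j\<le>t. of_bool (E j xs)) \<le> (1::real)"
      by (simp add: sum_of_bool_eq Int_def)
  qed
  finally show ?thesis unfolding U_def by simp
qed

text \<open>The path is cut at its last visit to \<open>G\<close> up to time \<open>t\<close>, which
  exists because the walk starts in \<open>G\<close>. Since \<open>G\<close> is a subgroup, the
  remaining path, recentred at that visit, avoids \<open>G\<close>.\<close>

lemma last_visit_bound:
  fixes G :: "(int \<times> int) set"
  assumes "0 \<in> G" and G: "\<And>x y. x \<in> G \<Longrightarrow> y \<in> G \<Longrightarrow> x - y \<in> G"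
  shows "pr t (avoids K) \<le>
    (\<Sum>j\<le>t. pr j (\<lambda>xs. avoids K xs \<and> sum_list xs \<in> G) * pr (t - j) (avoids G))"
proof -
  define U where "U xs \<longleftrightarrow> avoids K xs \<and> sum_list xs \<in> G" for xs
  have "pr t (avoids K) \<le> avg t (\<lambda>xs. \<Sum>j\<le>t. of_bool (U (take j xs)) * of_bool (avoids G (drop j xs)))"
  proof (rule avg_mono)
    fix xs assume xs: "xs \<in> paths t"
    have "\<exists>j\<le>t. U (take j xs) \<and> avoids G (drop j xs)" if "avoids K xs"
    proof -
      let ?P = "\<lambda>j. j \<le> t \<and> sum_list (take j xs) \<in> G"
      have "?P 0" using assms(1) by simp
      then obtain j where j: "?P j" "\<And>i. ?P i \<Longrightarrow> i \<le> j"
        using GreatestI_nat[of ?P 0 t] Greatest_le_nat[of ?P _ t] by blast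
      have "avoids G (drop j xs)"
        unfolding avoids_def sum_list_take_drop
      proof (intro allI impI notI)
        fix i assume i: "0 < i \<and> i \<le> length (drop j xs)"
          and *: "sum_list (take (j + i) xs) - sum_list (take j xs) \<in> G"
        have "- sum_list (take j xs) \<in> G"
          using G[OF assms(1) conjunct2[OF j(1)]] by simp
        then have "sum_list (take (j + i) xs) \<in> G"
          using G[OF *, of "- sum_list (take j xs)"] by simp
        moreover have "j + i \<le> t" using i xs by (auto simp: length_paths)
        ultimately show False using j(2)[of "j + i"] i by simp
      qed
      then show ?thesis using j that by (auto simp: U_def avoids_take)
    qed
    then show "of_bool (avoids K xs) \<le>
      (\<Sum>j\<le>t. of_bool (U (take j xs)) * (of_bool (avoids G (drop j xs)) :: real))"
      by (intro of_bool_le_sum) auto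
  qed
  also have "\<dots> = (\<Sum>j\<le>t. pr j U * pr (t - j) (avoids G))"
    unfolding avg_sum
  proof (rule sum.cong[OF refl])
    fix j assume "j \<in> {..t}"
    then show "avg t (\<lambda>xs. of_bool (U (take j xs)) * of_bool (avoids G (drop j xs)))
      = pr j U * pr (t - j) (avoids G)"
      using avg_split[of j "t - j" "\<lambda>xs. of_bool (U xs)" "\<lambda>xs. of_bool (avoids G xs)"] by simp
  qed
  finally show ?thesis unfolding U_def .
qed

section \<open>Avoidance estimates for half-planes, the row and the half-line\<close>

lemma sum_inverse_sqrt_le: "(\<Sum>s<n. 1 / sqrt (real (Suc s))) \<le> 2 * sqrt (real n)"
proof (induction n)
  case (Suc n)
  define a b where "a = sqrt (real n)" and "b = sqrt (real (Suc n))"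
  have ab: "0 \<le> a" "0 < b" "b * b = a * a + 1" by (auto simp: a_def b_def)
  \<comment> \<open>As \<open>a * a + b * b = 2 * b * b - 1\<close>, dividing by \<open>b\<close>
    gives the increment bound \<open>1 / b \<le> 2 * b - 2 * a\<close>.\<close>
  have "2 * (a * b) \<le> a * a + b * b" using sum_squares_bound[of a b] by (simp add: power2_eq_square)
  then have "2 * a + 1 / b \<le> 2 * b" using ab by (simp add: field_simps)
  with Suc show ?case by (simp add: a_def b_def)
qed simp

text \<open>\<open>unique_max_bound\<close> with \<open>G = UNIV\<close>: each of the
  \<open>t + 1\<close> summands is at least \<open>q t\<close>, so
  \<open>(t + 1) * q t * q t \<le> 1\<close>.\<close>

lemma pr_half_plane_le:
  fixes \<phi> :: "int \<times> int \<Rightarrow> int"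
  assumes "\<And>x y. \<phi> (x - y) = \<phi> x - \<phi> y"
  shows "pr t (avoids {x. 0 \<le> \<phi> x}) \<le> 1 / sqrt (real (Suc t))"
proof -
  define q where "q s = pr s (avoids {x. 0 \<le> \<phi> x})" for s
  have "real (Suc t) * q t * q t \<le> (\<Sum>j\<le>t. q j) * q t"
  proof (rule mult_right_mono)
    have "(\<Sum>j\<le>t. q t) \<le> (\<Sum>j\<le>t. q j)"
      by (rule sum_mono) (simp add: q_def pr_avoids_antimono)
    then show "real (Suc t) * q t \<le> (\<Sum>j\<le>t. q j)" by simp
  qed (simp add: q_def)
  also have "\<dots> \<le> 1"
    using unique_max_bound[of UNIV \<phi> "{x. 0 \<le> \<phi> x}" t] assms by (simp add: q_def)
  finally have "(q t)\<^sup>2 \<le> 1 / real (Suc t)"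
    by (simp add: power2_eq_square field_simps)
  then have "q t \<le> sqrt (1 / real (Suc t))" by (rule real_le_rsqrt)
  then show ?thesis by (simp add: q_def real_sqrt_divide)
qed

lemma unit_step_snd: "e \<in> unit_steps \<Longrightarrow> \<bar>snd e\<bar> \<le> 1"
  by (auto simp: unit_steps_def)

lemma snd_take_Suc:
  assumes "xs \<in> paths n" "i < n"
  shows "\<bar>snd (sum_list (take (Suc i) xs)) - snd (sum_list (take i xs))\<bar> \<le> 1"
proof -
  have "xs ! i \<in> unit_steps" using assms by (auto simp: paths_def)
  then show ?thesis using assms unit_step_snd by (auto simp: paths_def take_Suc_conv_app_nth)
qed

lemma snd_discrete_ivt:
  assumes "xs \<in> paths n" "i \<le> j" "j \<le> n"
    "snd (sum_list (take i xs)) \<le> k" "k \<le> snd (sum_list (take j xs))"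
  shows "\<exists>l. i \<le> l \<and> l \<le> j \<and> snd (sum_list (take l xs)) = k"
  by (rule nat_intermed_int_val) (use assms snd_take_Suc in auto)

abbreviation row :: "(int \<times> int) set" where "row \<equiv> {x. snd x = 0}"
abbreviation half_line :: "(int \<times> int) set" where "half_line \<equiv> {x. snd x = 0 \<and> 0 \<le> fst x}"

text \<open>The height changes by at most 1 per step, so a path that avoids the row stays strictly
  above or strictly below it after time 0, and each alternative is a half-plane event.\<close>

lemma pr_avoids_row_le: "pr t (avoids row) \<le> 2 / sqrt (real (Suc t))"
proof -
  have "pr t (avoids row) \<le> pr t (\<lambda>xs. avoids {x. 0 \<le> snd x} xs \<or> avoids {x. 0 \<le> - snd x} xs)"
  proof (rule pr_mono)
    fix xs assume xs: "xs \<in> paths t" and av: "avoids row xs"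
    define S where "S i = snd (sum_list (take i xs))" for i
    have S0: "S l \<noteq> 0" if "0 < l" "l \<le> t" for l
      using av xs that by (auto simp: avoids_def length_paths S_def)
    have "\<bar>S (Suc i) - S i\<bar> \<le> 1" if "i < t" for i
      using snd_take_Suc[OF xs that] by (simp add: S_def)
    then have step: "\<forall>i. 1 \<le> i \<and> i < l \<longrightarrow> \<bar>S (Suc i) - S i\<bar> \<le> 1"
      "\<forall>i. 1 \<le> i \<and> i < l \<longrightarrow> \<bar>(- S (Suc i)) - (- S i)\<bar> \<le> 1" if "l \<le> t" for l
      using that by (auto simp: abs_minus_commute)
    have neg: "S i < 0" if "S 1 < 0" "0 < i" "i \<le> t" for i
      using nat_intermed_int_val[OF step(1)[OF that(3)], of 0] S0 that by fastforce
    have pos: "0 < S i" if "0 < S 1" "0 < i" "i \<le> t" for i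
      using nat_intermed_int_val[OF step(2)[OF that(3)], of 0] S0 that by fastforce
    have "t = 0 \<or> S 1 < 0 \<or> 0 < S 1" using S0[of 1] by linarith
    then have "(\<forall>i. 0 < i \<and> i \<le> t \<longrightarrow> \<not> 0 \<le> S i) \<or> (\<forall>i. 0 < i \<and> i \<le> t \<longrightarrow> \<not> 0 \<le> - S i)"
      using neg pos by (metis le_zero_eq less_irrefl neg_0_le_iff_le not_le)
    then show "avoids {x. 0 \<le> snd x} xs \<or> avoids {x. 0 \<le> - snd x} xs"
      by (simp only: avoids_def length_paths[OF xs] S_def mem_Collect_eq)
  qed
  also have "\<dots> \<le> 1 / sqrt (real (Suc t)) + 1 / sqrt (real (Suc t))"
    by (rule order_trans[OF pr_disj_le]) (intro add_mono pr_half_plane_le; simp)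
  finally show ?thesis by simp
qed

text \<open>With \<open>U\<close> the expected number of visits to the row before the half-line is hit, the maximum
  decomposition gives \<open>U * q t \<le> 1\<close>, and the last visit to the row gives \<open>t * q t \<le> U * O(sqrt t)\<close>.\<close>
lemma pr_half_line:
  "(pr t (avoids half_line))\<^sup>2 \<le> 4 / sqrt (real (Suc t))"
proof -
  define q where "q s = pr s (avoids half_line)" for s
  define u where "u j = pr j (\<lambda>xs. avoids half_line xs \<and> sum_list xs \<in> row)" for j
  define v where "v s = pr s (avoids row)" for s
  have 1: "(\<Sum>j\<le>t. u j) * q t \<le> 1"
    unfolding u_def q_def by (rule unique_max_bound[where \<phi> = fst]) auto
  have q: "q s \<le> (\<Sum>j\<le>s. u j * v (s - j))" for s
    unfolding u_def q_def v_def by (rule last_visit_bound) auto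
  have "real (Suc t) * q t = (\<Sum>s\<le>t. q t)" by simp
  also have "\<dots> \<le> (\<Sum>s<Suc t. q s)"
    unfolding lessThan_Suc_atMost
    by (rule sum_mono) (simp add: q_def pr_avoids_antimono)
  also have "\<dots> \<le> (\<Sum>s<Suc t. \<Sum>j\<le>s. u j * v (s - j))"
    by (rule sum_mono) (rule q)
  also have "\<dots> \<le> (\<Sum>j<Suc t. u j) * (\<Sum>s<Suc t. v s)"
    by (rule convolution_le) (auto simp: u_def v_def)
  also have "(\<Sum>s<Suc t. v s) \<le> (\<Sum>s<Suc t. 2 * (1 / sqrt (real (Suc s))))"
    by (rule sum_mono) (use pr_avoids_row_le in \<open>simp add: v_def\<close>)
  also have "\<dots> = 2 * (\<Sum>s<Suc t. 1 / sqrt (real (Suc s)))"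
    by (rule sum_distrib_left[symmetric])
  also have "\<dots> \<le> 2 * (2 * sqrt (real (Suc t)))"
    by (intro mult_left_mono sum_inverse_sqrt_le) simp
  finally have "real (Suc t) * q t \<le> (\<Sum>j\<le>t. u j) * (4 * sqrt (real (Suc t)))"
    by (simp add: lessThan_Suc_atMost mult_left_mono sum_nonneg u_def)
  then have "real (Suc t) * q t * q t \<le> (\<Sum>j\<le>t. u j) * (4 * sqrt (real (Suc t))) * q t"
    by (rule mult_right_mono) (simp add: q_def)
  also have "\<dots> \<le> 4 * sqrt (real (Suc t))"
    using mult_left_mono[OF 1, of "4 * sqrt (real (Suc t))"] by (simp add: mult_ac)
  finally have "(q t)\<^sup>2 \<le> 4 * sqrt (real (Suc t)) / real (Suc t)"
    by (simp add: power2_eq_square field_simps)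
  also have "\<dots> = 4 / sqrt (real (Suc t))"
    by (simp add: field_simps)
  finally show ?thesis unfolding q_def .
qed

text \<open>Cauchy-Schwarz needs only the bound on the squares: the sum is at most the root of
  \<open>n * 8 * sqrt n\<close>.\<close>

lemma sum_half_line_le:
  "(\<Sum>s<n. pr s (avoids half_line)) \<le> sqrt 8 * real n powr (3 / 4)"
proof -
  define q where "q s = pr s (avoids half_line)" for s
  have "(\<Sum>s<n. 1 * q s)\<^sup>2 \<le> (\<Sum>s<n. 1\<^sup>2) * (\<Sum>s<n. (q s)\<^sup>2)"
    by (rule Cauchy_Schwarz_ineq_sum)
  also have "\<dots> \<le> real n * (\<Sum>s<n. 4 * (1 / sqrt (real (Suc s))))"
    by (auto intro!: mult_left_mono sum_mono simp: q_def intro: order_trans[OF pr_half_line])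
  also have "\<dots> = real n * (4 * (\<Sum>s<n. 1 / sqrt (real (Suc s))))"
    by (simp only: sum_distrib_left)
  also have "\<dots> \<le> real n * (4 * (2 * sqrt (real n)))"
    by (intro mult_left_mono sum_inverse_sqrt_le) auto
  also have "\<dots> = (sqrt 8 * real n powr (3 / 4))\<^sup>2"
    using powr_add[of "real n" 1 "1 / 2"]
    by (cases "n = 0") (simp_all add: power_mult_distrib powr_power powr_half_sqrt)
  finally show ?thesis unfolding q_def mult_1 by (rule power2_le_imp_le) simp
qed

text \<open>A downward step put in front of the path has probability 1/4 and turns avoidance of the
  open half-plane into avoidance of the closed one, at the cost of a factor 4.\<close>

lemma pr_snd_le_0: "pr t (avoids {x. 0 < snd x}) \<le> 4 / sqrt (real (Suc t))"
proof -
  have "pr t (avoids {x. 0 < snd x}) / 4 \<le> pr (Suc t) (avoids {x. 0 \<le> snd x})"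
  proof -
    have "(1/4) * pr t (avoids {x. 0 < snd x}) = 
       avg (1 + t) (\<lambda>xs. of_bool (take 1 xs = [(0, -1)]) * of_bool (avoids {x. 0 < snd x} (drop 1 xs)))"
      unfolding avg_split[of 1 t "\<lambda>xs. of_bool (xs = [(0, -1)])" "\<lambda>xs. of_bool (avoids {x. 0 < snd x} xs)"]
      by (simp add: avg_Suc avg_0 unit_steps_def)
    also have "\<dots> \<le> pr (1 + t) (avoids {x. 0 \<le> snd x})"
    proof (rule avg_mono)
      fix xs :: "(int \<times> int) list"
      have "avoids {x. 0 \<le> snd x} ((0, -1) # ys)" if "avoids {x. 0 < snd x} ys" for ys
        unfolding avoids_def
      proof (intro allI impI)
        fix i assume i: "0 < i \<and> i \<le> length ((0, -1) # ys)"
        then obtain k where k: "i = Suc k" "k \<le> length ys" by (cases i) auto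
        then have "snd (sum_list (take k ys)) \<le> 0"
          using that by (cases "k = 0") (auto simp: avoids_def not_less)
        then show "sum_list (take i ((0, -1) # ys)) \<notin> {x. 0 \<le> snd x}" by (simp add: k)
      qed
      then show "of_bool (take 1 xs = [(0, -1)]) * of_bool (avoids {x. 0 < snd x} (drop 1 xs))
        \<le> (of_bool (avoids {x. 0 \<le> snd x} xs) :: real)"
        by (cases xs) auto
    qed
    finally show ?thesis by simp
  qed
  also have "\<dots> \<le> 1 / sqrt (real (Suc (Suc t)))"
    by (rule pr_half_plane_le) simp
  also have "\<dots> \<le> 1 / sqrt (real (Suc t))"
    by (simp add: field_simps)
  finally show ?thesis by (simp add: field_simps)
qed

section \<open>Rightmost visits\<close>

text \<open>On the event on the left, every time in \<open>{h..<n}\<close> lies in the gap after one of the first \<open>r\<close>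
  times of \<open>A\<close>, while the expected total length of these gaps is at most the right-hand side.\<close>
lemma renewal_gap:
  assumes gap: "\<And>xs m t. m \<le> t \<Longrightarrow> t \<le> length xs \<Longrightarrow> A (take m xs) \<Longrightarrow>
      (\<And>i. m < i \<Longrightarrow> i \<le> t \<Longrightarrow> \<not> A (take i xs)) \<Longrightarrow> avoids K (drop m (take t xs))"
  shows "real (n - h) * pr n (\<lambda>xs. card {m. m < n \<and> A (take m xs)} \<le> r \<and> (\<exists>m\<le>h. A (take m xs)))
    \<le> real r * (\<Sum>s<n. pr s (avoids K))"
proof -
  \<comment> \<open>\<open>c\<close> is the rank, counted from 0, of a time among the times of
    \<open>A\<close>, and \<open>A'\<close> keeps the first \<open>r\<close> of them. Both depend
    only on the prefix, so that \<open>avg_split\<close> applies to \<open>A'\<close> and the path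
    after it.\<close>
  define c where "c xs = card {i. i < length xs \<and> A (take i xs)}" for xs
  define A' where "A' xs \<longleftrightarrow> A xs \<and> c xs < r" for xs
  define F :: "(int \<times> int) list \<Rightarrow> real" where
    "F xs = (\<Sum>t<n. \<Sum>m\<le>t. of_bool (A' (take m xs)) * of_bool (avoids K (drop m (take t xs))))" for xs
  have c_take: "c (take m xs) = card {i. i < m \<and> A (take i xs)}" if "m \<le> length xs" for m xs
    unfolding c_def using that by (intro arg_cong[of _ _ card]) (auto simp: min_def)
  have c_less: "c (take m xs) < card {i. i < m' \<and> A (take i xs)}"
    if "m < m'" "m' \<le> length xs" "A (take m xs)" for m m' xs
    unfolding c_take[OF less_imp_le[OF less_le_trans[OF that(1,2)]]]
    by (rule psubset_card_mono) (use that in auto)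
  have "real (n - h) * pr n (\<lambda>xs. card {m. m < n \<and> A (take m xs)} \<le> r \<and> (\<exists>m\<le>h. A (take m xs)))
      \<le> avg n F"
    unfolding avg_cmult[symmetric]
  proof (rule avg_mono)
    fix xs assume xs: "xs \<in> paths n"
    show "real (n - h) * of_bool (card {m. m < n \<and> A (take m xs)} \<le> r \<and> (\<exists>m\<le>h. A (take m xs))) \<le> F xs"
    proof (cases "card {m. m < n \<and> A (take m xs)} \<le> r \<and> (\<exists>m\<le>h. A (take m xs))")
      case True
      then obtain m0 where m0: "m0 \<le> h" "A (take m0 xs)" by blast
      have one: "1 \<le> (\<Sum>m\<le>t. of_bool (A' (take m xs)) * of_bool (avoids K (drop m (take t xs))) :: real)"
        if t: "h \<le> t" "t < n" for t
      proof -
        let ?P = "\<lambda>m. m \<le> t \<and> A (take m xs)"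
        have "?P m0" using m0 t by simp
        then obtain m where m: "?P m" "\<And>i. ?P i \<Longrightarrow> i \<le> m"
          using GreatestI_nat[of ?P m0 t] Greatest_le_nat[of ?P _ t] by blast
        have "\<not> A (take i xs)" if "m < i" "i \<le> t" for i
          using m(2)[of i] that by auto
        then have "avoids K (drop m (take t xs))"
          using gap[of m t xs] m(1) t by (simp add: length_paths[OF xs])
        \<comment> \<open>The time \<open>m\<close> itself is one of the at most \<open>r\<close>
          times of \<open>A\<close> but does not count towards its own rank, hence the strict
          inequality.\<close>
        moreover have "c (take m xs) < r"
          using c_less[of m n xs] m t xs True by (simp add: length_paths)
        ultimately have ex: "\<exists>m\<in>{..t}. 1 \<le> (of_bool (A' (take m xs)) * of_bool (avoids K (drop m (take t xs))) :: real)"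
          using m by (intro bexI[of _ m]) (auto simp: A'_def)
        have "of_bool True \<le> (\<Sum>m\<le>t. of_bool (A' (take m xs)) * of_bool (avoids K (drop m (take t xs))) :: real)"
          by (rule of_bool_le_sum) (simp, simp, rule ex)
        then show ?thesis by (simp only: of_bool_eq)
      qed
      have "real (n - h) = (\<Sum>t\<in>{h..<n}. 1)" by simp
      also have "\<dots> \<le> (\<Sum>t\<in>{h..<n}. \<Sum>m\<le>t. of_bool (A' (take m xs)) * of_bool (avoids K (drop m (take t xs))))"
        by (rule sum_mono) (use one in auto)
      also have "\<dots> \<le> F xs"
        unfolding F_def by (rule sum_mono2) (auto intro!: sum_nonneg)
      finally show ?thesis using True by simp
    next
      case False
      have "0 \<le> F xs"
        unfolding F_def by (intro sum_nonneg mult_nonneg_nonneg) simp_all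
      with False show ?thesis by (simp only: of_bool_eq mult_zero_right)
    qed
  qed
  also have "avg n F = (\<Sum>t<n. \<Sum>m\<le>t. pr m A' * pr (t - m) (avoids K))"
    unfolding F_def avg_sum
  proof (intro sum.cong refl)
    fix t m assume tm: "t \<in> {..<n}" "m \<in> {..t}"
    have "avg n (\<lambda>xs. of_bool (A' (take m xs)) * of_bool (avoids K (drop m (take t xs))))
      = avg n (\<lambda>xs. of_bool (A' (take m (take t xs))) * of_bool (avoids K (drop m (take t xs))))"
      using tm by (simp add: min_def)
    also have "\<dots> = avg t (\<lambda>xs. of_bool (A' (take m xs)) * of_bool (avoids K (drop m xs)))"
      using avg_take[of t n "\<lambda>xs. of_bool (A' (take m xs)) * of_bool (avoids K (drop m xs))"] tm by simp
    also have "\<dots> = pr m A' * pr (t - m) (avoids K)"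
      using avg_split[of m "t - m" "\<lambda>xs. of_bool (A' xs)" "\<lambda>xs. of_bool (avoids K xs)"] tm by simp
    finally show "avg n (\<lambda>xs. of_bool (A' (take m xs)) * of_bool (avoids K (drop m (take t xs))))
      = pr m A' * pr (t - m) (avoids K)" .
  qed
  also have "\<dots> \<le> (\<Sum>m<n. pr m A') * (\<Sum>s<n. pr s (avoids K))"
    by (rule convolution_le) auto
  also have "\<dots> \<le> real r * (\<Sum>s<n. pr s (avoids K))"
  proof (rule mult_right_mono)
    have "(\<Sum>m<n. pr m A') = avg n (\<lambda>xs. \<Sum>m<n. of_bool (A' (take m xs)))"
      unfolding avg_sum by (rule sum.cong) (auto simp: avg_take[of _ n "\<lambda>xs. of_bool (A' xs)"])
    also have "\<dots> \<le> avg n (\<lambda>_. real r)"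
    proof (rule avg_mono)
      fix xs assume xs: "xs \<in> paths n"
      \<comment> \<open>Ranks are distinct and less than \<open>r\<close>, so at most
        \<open>r\<close> times satisfy \<open>A'\<close>.\<close>
      have "card {m. m < n \<and> A' (take m xs)} \<le> card {..<r}"
      proof (rule card_inj_on_le)
        show "inj_on (\<lambda>m. c (take m xs)) {m. m < n \<and> A' (take m xs)}"
        proof (rule linorder_inj_onI)
          fix m m' assume "m < m'" "m \<in> {m. m < n \<and> A' (take m xs)}" "m' \<in> {m. m < n \<and> A' (take m xs)}"
          then show "c (take m xs) \<noteq> c (take m' xs)"
            using c_less[of m m' xs] c_take[of m' xs] xs by (simp add: A'_def length_paths)
        qed auto
      qed (auto simp: A'_def)
      then show "(\<Sum>m<n. of_bool (A' (take m xs))) \<le> real r"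
        by (simp add: sum_of_bool_eq Int_def)
    qed
    finally show "(\<Sum>m<n. pr m A') \<le> real r" by simp
  qed (auto intro: sum_nonneg)
  finally show ?thesis .
qed

section \<open>First hits, and the time to reach a given height\<close>

lemma not_avoids_first:
  assumes "\<not> avoids K (drop m (take t xs))" "t \<le> length xs"
  obtains i where "m < i" "i \<le> t" "sum_list (take i xs) - sum_list (take m xs) \<in> K"
    "\<And>l. m < l \<Longrightarrow> l < i \<Longrightarrow> sum_list (take l xs) - sum_list (take m xs) \<notin> K"
proof -
  let ?P = "\<lambda>i. m < i \<and> i \<le> t \<and> sum_list (take i xs) - sum_list (take m xs) \<in> K"
  obtain d where d: "0 < d" "d \<le> t - m" "sum_list (take d (drop m (take t xs))) \<in> K"
    using assms by (auto simp: avoids_def)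
  then have "m + d \<le> t" by simp
  with d have "?P (m + d)"
    by (simp add: sum_list_take_drop min_def)
  then have P: "?P (LEAST i. ?P i)" by (rule LeastI)
  have min: "\<not> ?P l" if "l < (LEAST i. ?P i)" for l
    using not_less_Least[OF that] .
  show thesis
  proof (rule that)
    fix l assume l: "m < l" "l < (LEAST i. ?P i)"
    then have "l \<le> t" using P by linarith
    with l show "sum_list (take l xs) - sum_list (take m xs) \<notin> K" using min by blast
  qed (use P in blast)+
qed

text \<open>Here \<open>A\<close> marks the strict record heights. If level \<open>k\<close> is
  missed up to time \<open>h\<close>, all heights stay below \<open>k\<close>, and the records,
  having distinct values in \<open>{0..<k}\<close>, number at most \<open>k\<close>. So few records
  are unlikely to have gaps that fill the whole time.\<close>

lemma pr_level_not_hit: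
  assumes "h < n"
  shows "pr n (\<lambda>xs. \<forall>m\<le>h. snd (sum_list (take m xs)) \<noteq> int k) \<le> 8 * real k / sqrt (real (Suc h))"
proof -
  define A :: "(int \<times> int) list \<Rightarrow> bool" where
    "A xs \<longleftrightarrow> (\<forall>i<length xs. snd (sum_list (take i xs)) < snd (sum_list xs))" for xs
  have A_take: "A (take m xs) \<longleftrightarrow> (\<forall>i<m. snd (sum_list (take i xs)) < snd (sum_list (take m xs)))"
    if "m \<le> length xs" for m xs
    using that by (auto simp: A_def min_def)
  have "pr n (\<lambda>xs. \<forall>m\<le>h. snd (sum_list (take m xs)) \<noteq> int k)
      = pr n (\<lambda>xs. \<forall>m\<le>h. snd (sum_list (take m (take (Suc h) xs))) \<noteq> int k)"
    by (rule avg_cong) (auto simp: min_def)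
  also have "\<dots> = pr (Suc h) (\<lambda>xs. \<forall>m\<le>h. snd (sum_list (take m xs)) \<noteq> int k)"
    using avg_take[of "Suc h" n "\<lambda>xs. of_bool (\<forall>m\<le>h. snd (sum_list (take m xs)) \<noteq> int k)"] assms by simp
  also have "\<dots> \<le> pr (Suc h) (\<lambda>xs. card {m. m < Suc h \<and> A (take m xs)} \<le> k \<and> (\<exists>m\<le>0. A (take m xs)))"
  proof (rule pr_mono, intro conjI)
    fix xs assume xs: "xs \<in> paths (Suc h)" and ne: "\<forall>m\<le>h. snd (sum_list (take m xs)) \<noteq> int k"
    define S where "S i = snd (sum_list (take i xs))" for i
    have lt: "S i < int k" if "i \<le> h" for i
      using snd_discrete_ivt[OF xs, of 0 i "int k"] ne that by (force simp: S_def)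
    have A: "S i < S m" if "A (take m xs)" "i < m" "m \<le> h" for i m
      using that xs by (auto simp: A_def S_def length_paths min_def)
    have "card {m. m < Suc h \<and> A (take m xs)} \<le> card {0..<int k}"
    proof (rule card_inj_on_le)
      show "inj_on S {m. m < Suc h \<and> A (take m xs)}"
        by (rule linorder_inj_onI) (auto dest: A)
      have "0 \<le> S m" if "A (take m xs)" "m \<le> h" for m
        using A[OF that(1), of 0] that(2) by (cases "m = 0") (auto simp: S_def)
      then show "S ` {m. m < Suc h \<and> A (take m xs)} \<subseteq> {0..<int k}"
        using lt by auto
    qed simp
    then show "card {m. m < Suc h \<and> A (take m xs)} \<le> k" by simp
    show "\<exists>m\<le>0. A (take m xs)" by (simp add: A_def)
  qed
  finally have 1: "pr n (\<lambda>xs. \<forall>m\<le>h. snd (sum_list (take m xs)) \<noteq> int k)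
    \<le> pr (Suc h) (\<lambda>xs. card {m. m < Suc h \<and> A (take m xs)} \<le> k \<and> (\<exists>m\<le>0. A (take m xs)))" .
  \<comment> \<open>The empty prefix is a record, so the gaps must cover all \<open>Suc h\<close>
    times. The first position above a record height is the next record, which is the gap
    hypothesis.\<close>
  have "real (Suc h - 0) * pr (Suc h) (\<lambda>xs. card {m. m < Suc h \<and> A (take m xs)} \<le> k \<and> (\<exists>m\<le>0. A (take m xs)))
    \<le> real k * (\<Sum>s<Suc h. pr s (avoids {x. 0 < snd x}))"
  proof (rule renewal_gap, rule ccontr)
    fix xs :: "(int \<times> int) list" and m t
    assume mt: "m \<le> t" "t \<le> length xs" "A (take m xs)" "\<And>i. m < i \<Longrightarrow> i \<le> t \<Longrightarrow> \<not> A (take i xs)"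
      and na: "\<not> avoids {x. 0 < snd x} (drop m (take t xs))"
    obtain i where i: "m < i" "i \<le> t" "sum_list (take i xs) - sum_list (take m xs) \<in> {x. 0 < snd x}"
      "\<And>l. m < l \<Longrightarrow> l < i \<Longrightarrow> sum_list (take l xs) - sum_list (take m xs) \<notin> {x. 0 < snd x}"
      by (rule not_avoids_first[OF na mt(2)]) blast
    have "snd (sum_list (take l xs)) < snd (sum_list (take i xs))" if "l < i" for l
    proof (cases l m rule: linorder_cases)
      case less
      then have "snd (sum_list (take l xs)) < snd (sum_list (take m xs))"
        using mt A_take[of m xs] by simp
      then show ?thesis using i(3) by simp
    next
      case greater
      then show ?thesis using i(3) i(4)[of l] that by simp
    qed (use i in simp)
    then have "A (take i xs)" using i mt by (simp add: A_take)
    then show False using mt(4) i by blast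
  qed
  also have "\<dots> \<le> real k * (\<Sum>s<Suc h. 4 * (1 / sqrt (real (Suc s))))"
    by (intro mult_left_mono sum_mono) (use pr_snd_le_0 in auto)
  also have "\<dots> = real k * (4 * (\<Sum>s<Suc h. 1 / sqrt (real (Suc s))))"
    by (simp only: sum_distrib_left)
  also have "\<dots> \<le> real k * (4 * (2 * sqrt (real (Suc h))))"
    by (intro mult_left_mono sum_inverse_sqrt_le) auto
  finally have "pr (Suc h) (\<lambda>xs. card {m. m < Suc h \<and> A (take m xs)} \<le> k \<and> (\<exists>m\<le>0. A (take m xs)))
    \<le> real k * (4 * (2 * sqrt (real (Suc h)))) / real (Suc h)"
    by (simp add: field_simps)
  also have "\<dots> = 8 * real k * (sqrt (real (Suc h)) / real (Suc h))"
    by simp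
  also have "\<dots> = 8 * real k / sqrt (real (Suc h))"
    by (simp only: sqrt_divide_self_eq[OF of_nat_0_le_iff] inverse_eq_divide times_divide_eq_right mult_1_right)
  finally show ?thesis using 1 by linarith
qed

text \<open>The comparison is weak, so a return to the rightmost site counts again; this matches the
  origin belonging to \<open>half_line\<close>. A first visit to a row counts vacuously.\<close>

definition rightmost :: "(int \<times> int) list \<Rightarrow> bool" where
  "rightmost xs \<longleftrightarrow> (\<forall>i<length xs. snd (sum_list (take i xs)) = snd (sum_list xs) \<longrightarrow>
     fst (sum_list (take i xs)) \<le> fst (sum_list xs))"

abbreviation row_rightmost :: "int \<Rightarrow> (int \<times> int) list \<Rightarrow> bool" where
  "row_rightmost k xs \<equiv> rightmost xs \<and> snd (sum_list xs) = k"

lemma rightmost_take: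
  assumes "m \<le> length xs"
  shows "rightmost (take m xs) \<longleftrightarrow> (\<forall>i<m. snd (sum_list (take i xs)) = snd (sum_list (take m xs)) \<longrightarrow>
     fst (sum_list (take i xs)) \<le> fst (sum_list (take m xs)))"
  using assms by (auto simp: rightmost_def min_def)

text \<open>The first hit of the half-line based at a rightmost visit is again rightmost: visits to
  the row before \<open>m\<close> are not to the right of the base, and those in between are
  strictly to its left.\<close>

lemma row_rightmost_gap:
  assumes mt: "m \<le> t" "t \<le> length xs" "row_rightmost k (take m xs)"
    and no: "\<And>i. m < i \<Longrightarrow> i \<le> t \<Longrightarrow> \<not> row_rightmost k (take i xs)"
  shows "avoids half_line (drop m (take t xs))"
proof (rule ccontr)
  assume na: "\<not> avoids half_line (drop m (take t xs))"
  obtain i where i: "m < i" "i \<le> t" "sum_list (take i xs) - sum_list (take m xs) \<in> half_line"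
    "\<And>l. m < l \<Longrightarrow> l < i \<Longrightarrow> sum_list (take l xs) - sum_list (take m xs) \<notin> half_line"
    by (rule not_avoids_first[OF na mt(2)]) blast
  have k: "snd (sum_list (take i xs)) = k" using i(3) mt(3) by simp
  have "fst (sum_list (take l xs)) \<le> fst (sum_list (take i xs))"
    if "l < i" "snd (sum_list (take l xs)) = k" for l
  proof (cases l m rule: linorder_cases)
    case less
    then have "fst (sum_list (take l xs)) \<le> fst (sum_list (take m xs))"
      using mt that by (auto simp: rightmost_take)
    then show ?thesis using i(3) by simp
  next
    case greater
    then show ?thesis using i(3) i(4)[of l] that mt(3) by simp
  qed (use i in simp)
  then have "row_rightmost k (take i xs)" using i mt k by (auto simp: rightmost_take)
  then show False using no i by blast
qed

text \<open>Either the row is missed up to time \<open>h\<close>, or its first visit is a rightmost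
  visit by time \<open>h\<close> and \<open>renewal_gap\<close> applies. The two summands belong to
  these cases in reverse order.\<close>

lemma pr_few_row_rightmost:
  assumes "h < n"
  shows "pr n (\<lambda>xs. card {m. m < n \<and> row_rightmost (int k) (take m xs)} \<le> r)
    \<le> real r * (sqrt 8 * real n powr (3 / 4)) / real (n - h) + 8 * real k / sqrt (real (Suc h))"
proof -
  let ?few = "\<lambda>xs. card {m. m < n \<and> row_rightmost (int k) (take m xs)} \<le> r"
  have "pr n ?few \<le> pr n (\<lambda>xs. (?few xs \<and> (\<exists>m\<le>h. row_rightmost (int k) (take m xs)))
      \<or> (\<forall>m\<le>h. snd (sum_list (take m xs)) \<noteq> int k))"
  proof (rule pr_mono)
    fix xs assume xs: "xs \<in> paths n" and few: "?few xs"
    have "\<exists>m\<le>h. row_rightmost (int k) (take m xs)" if hit: "\<exists>m\<le>h. snd (sum_list (take m xs)) = int k"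
    proof -
      let ?P = "\<lambda>m. snd (sum_list (take m xs)) = int k"
      obtain m where m: "m \<le> h" "?P m" using hit by metis
      have "\<not> ?P i" if "i < (LEAST i. ?P i)" for i using not_less_Least[OF that] .
      moreover have P: "?P (LEAST i. ?P i)" using m(2) by (rule LeastI)
      moreover have "(LEAST i. ?P i) \<le> m" using m(2) by (rule Least_le)
      ultimately have "rightmost (take (LEAST i. ?P i) xs)" "(LEAST i. ?P i) \<le> h"
        using m(1) assms by (auto simp: rightmost_take length_paths[OF xs])
      with P show ?thesis by blast
    qed
    with few show "(?few xs \<and> (\<exists>m\<le>h. row_rightmost (int k) (take m xs)))
      \<or> (\<forall>m\<le>h. snd (sum_list (take m xs)) \<noteq> int k)" by blast
  qed
  also have "\<dots> \<le> pr n (\<lambda>xs. ?few xs \<and> (\<exists>m\<le>h. row_rightmost (int k) (take m xs)))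
      + pr n (\<lambda>xs. \<forall>m\<le>h. snd (sum_list (take m xs)) \<noteq> int k)"
    by (rule pr_disj_le)
  also have "\<dots> \<le> real r * (sqrt 8 * real n powr (3 / 4)) / real (n - h) + 8 * real k / sqrt (real (Suc h))"
  proof (rule add_mono[OF _ pr_level_not_hit[OF assms]])
    have "real (n - h) * pr n (\<lambda>xs. ?few xs \<and> (\<exists>m\<le>h. row_rightmost (int k) (take m xs)))
        \<le> real r * (\<Sum>s<n. pr s (avoids half_line))"
      by (rule renewal_gap) (rule row_rightmost_gap)
    also have "\<dots> \<le> real r * (sqrt 8 * real n powr (3 / 4))"
      by (intro mult_left_mono sum_half_line_le) simp
    finally show "pr n (\<lambda>xs. ?few xs \<and> (\<exists>m\<le>h. row_rightmost (int k) (take m xs)))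
      \<le> real r * (sqrt 8 * real n powr (3 / 4)) / real (n - h)"
      using assms by (simp add: field_simps)
  qed
  finally show ?thesis .
qed

text \<open>Visits in different rows are disjoint. Too small a total forces at least half of the
  \<open>K\<close> rows to be bad, and Markov's inequality at the threshold \<open>K / 2\<close>
  produces the factor 2.\<close>

lemma pr_few_rightmost:
  assumes \<beta>: "\<And>k. k < K \<Longrightarrow> pr n (\<lambda>xs. card {m. m < n \<and> row_rightmost (int k) (take m xs)} \<le> r) \<le> \<beta>"
    and "0 < K"
  shows "pr n (\<lambda>xs. 2 * real (card {m. m < n \<and> rightmost (take m xs)}) < real K * real r) \<le> 2 * \<beta>"
proof -
  define N where "N k xs = card {m. m < n \<and> row_rightmost (int k) (take m xs)}" for k xs
  define bad where "bad xs = (\<Sum>k<K. of_bool (N k xs \<le> r) :: real)" for xs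
  have "pr n (\<lambda>xs. 2 * real (card {m. m < n \<and> rightmost (take m xs)}) < real K * real r)
      \<le> pr n (\<lambda>xs. real K / 2 \<le> bad xs)"
  proof (rule pr_mono, rule ccontr)
    fix xs assume few: "2 * real (card {m. m < n \<and> rightmost (take m xs)}) < real K * real r"
      and "\<not> real K / 2 \<le> bad xs"
    then have "bad xs \<le> real K / 2" by simp
    have "(\<Sum>k<K. N k xs) = card (\<Union>k\<in>{..<K}. {m. m < n \<and> row_rightmost (int k) (take m xs)})"
      unfolding N_def by (subst card_UN_disjoint) auto
    also have "\<dots> \<le> card {m. m < n \<and> rightmost (take m xs)}"
      by (rule card_mono) auto
    finally have 1: "(\<Sum>k<K. real (N k xs)) \<le> real (card {m. m < n \<and> rightmost (take m xs)})"
      by (simp flip: of_nat_sum)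
    \<comment> \<open>Each of the \<open>K - bad xs\<close> good rows contributes at least
      \<open>r\<close>.\<close>
    have "(real K - bad xs) * real r = (\<Sum>k<K. real r * (1 - of_bool (N k xs \<le> r)))"
      unfolding bad_def by (simp add: sum_subtractf sum_distrib_left[symmetric] algebra_simps)
    also have "\<dots> \<le> (\<Sum>k<K. real (N k xs))"
      by (rule sum_mono) auto
    finally have "(real K - bad xs) * real r \<le> real (card {m. m < n \<and> rightmost (take m xs)})"
      using 1 by linarith
    moreover have "(real K / 2) * real r \<le> (real K - bad xs) * real r"
      by (rule mult_right_mono) (use \<open>bad xs \<le> real K / 2\<close> in auto)
    ultimately show False using few by (simp add: mult.commute)
  qed
  also have "real K / 2 * \<dots> \<le> avg n bad"
    by (rule pr_markov) (use \<open>0 < K\<close> in \<open>auto simp: bad_def intro: sum_nonneg\<close>)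
  also have "avg n bad = (\<Sum>k<K. pr n (\<lambda>xs. N k xs \<le> r))"
    unfolding bad_def avg_sum ..
  also have "\<dots> \<le> (\<Sum>k<K. \<beta>)"
    unfolding N_def by (rule sum_mono) (use \<beta> in auto)
  finally show ?thesis
    using \<open>0 < K\<close> by (simp add: mult_left_mono field_simps)
qed

section \<open>Second moment of the compensated number of right steps\<close>

definition right_martingale :: "(int \<times> int) list \<Rightarrow> real" where
  "right_martingale xs =
     (\<Sum>m<length xs. of_bool (rightmost (take m xs)) * (of_bool (xs ! m = (1, 0)) - 1 / 4))"

text \<open>The increment is a factor determined by the past times a centred function of the new
  step: this is the martingale property.\<close>

lemma right_martingale_snoc:
  "right_martingale (xs @ [e]) =
     right_martingale xs + of_bool (rightmost xs) * (of_bool (e = (1, 0)) - 1 / 4)"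
  by (simp add: right_martingale_def nth_append)

text \<open>The cross term vanishes on summing over the four steps, and the conditional variance of
  an increment is at most 3/16, hence below 1.\<close>

lemma avg_right_martingale_sq: "avg n (\<lambda>xs. (right_martingale xs)\<^sup>2) \<le> real n"
proof (induction n)
  case 0
  then show ?case by (simp add: avg_0 right_martingale_def)
next
  case (Suc n)
  have "avg (Suc n) (\<lambda>xs. (right_martingale xs)\<^sup>2) \<le> avg n (\<lambda>xs. (right_martingale xs)\<^sup>2 + 1)"
    unfolding avg_Suc right_martingale_snoc
    by (rule avg_mono) (auto simp: unit_steps_def power2_eq_square field_simps)
  also have "\<dots> \<le> real (Suc n)"
    using Suc by (simp add: avg_add)
  finally show ?case .
qed

lemma right_martingale_eq:
  assumes "length xs = n"
  shows "right_martingale xs = real (card {m. m < n \<and> rightmost (take m xs) \<and> xs ! m = (1, 0)})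
    - real (card {m. m < n \<and> rightmost (take m xs)}) / 4"
proof -
  have "right_martingale xs = (\<Sum>m<n. of_bool (rightmost (take m xs) \<and> xs ! m = (1, 0)))
      - (\<Sum>m<n. of_bool (rightmost (take m xs))) / 4"
    unfolding right_martingale_def assms
    by (simp add: right_diff_distrib sum_subtractf of_bool_conj flip: sum_divide_distrib)
  then show ?thesis by (simp add: sum_of_bool_eq Int_def)
qed

text \<open>Chebyshev's inequality.\<close>

lemma pr_right_martingale:
  assumes "c > 0" shows "pr n (\<lambda>xs. c \<le> \<bar>right_martingale xs\<bar>) \<le> real n / c\<^sup>2"
proof -
  have "pr n (\<lambda>xs. c \<le> \<bar>right_martingale xs\<bar>) \<le> pr n (\<lambda>xs. c\<^sup>2 \<le> (right_martingale xs)\<^sup>2)"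
    by (rule pr_mono) (use assms in \<open>simp add: abs_le_square_iff[symmetric]\<close>)
  also have "c\<^sup>2 * \<dots> \<le> avg n (\<lambda>xs. (right_martingale xs)\<^sup>2)"
    by (rule pr_markov) (use assms in auto)
  also have "\<dots> \<le> real n" by (rule avg_right_martingale_sq)
  finally show ?thesis using assms by (simp add: field_simps)
qed

abbreviation right_extensions :: "(int \<times> int) list \<Rightarrow> nat" where
  "right_extensions xs \<equiv> card {m. m < length xs \<and> rightmost (take m xs) \<and> xs ! m = (1, 0)}"

text \<open>The error 37 \<eta> is twice the sum of 6 \<eta> (a row reached early but with few
  rightmost visits) and 12 \<eta> (a row reached late), plus \<eta> for the martingale.\<close>

lemma pr_few_extensions:
  fixes \<eta> :: real
  assumes \<eta>: "0 < \<eta>"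
  shows "\<forall>\<^sub>F n in sequentially.
    pr n (\<lambda>xs. real (right_extensions xs) < \<eta>\<^sup>2 / 64 * real n powr (3 / 4)) \<le> 37 * \<eta>"
proof -
  have "filterlim (\<lambda>n. real n powr (1 / 4)) at_top sequentially"
    by real_asymp
  \<comment> \<open>The three terms serve, in order, for \<open>x \<le> x\<^sup>2\<close>, for the
    floors below to lose at most a factor 2, and for
    \<open>real n / c\<^sup>2 \<le> \<eta>\<close>.\<close>
  then have "\<forall>\<^sub>F n in sequentially. 1 + 2 / \<eta> + 4096 / \<eta> ^ 5 \<le> real n powr (1 / 4)"
    by (simp add: filterlim_at_top)
  then show ?thesis
  proof eventually_elim
    case (elim n)
    define x where "x = real n powr (1 / 4)"
    have pos: "0 \<le> 2 / \<eta>" "0 \<le> 4096 / \<eta> ^ 5" using \<eta> by auto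
    then have ge: "1 \<le> x" "2 / \<eta> \<le> x" "4096 / \<eta> ^ 5 \<le> x" using elim unfolding x_def by linarith+
    then have "0 < n" by (cases "n = 0") (simp_all add: x_def)
    have x: "1 \<le> x" "2 \<le> \<eta> * x" "4096 \<le> \<eta> ^ 5 * x" using ge \<eta> by (simp_all add: field_simps)
    have n: "real n = x ^ 4" "sqrt (real n) = x\<^sup>2" "real n powr (3 / 4) = x ^ 3"
      using \<open>0 < n\<close> by (simp_all add: x_def powr_power powr_half_sqrt[symmetric])
    have "x * 1 \<le> x * x" using x by (intro mult_left_mono) auto
    then have "x \<le> x\<^sup>2" by (simp add: power2_eq_square)
    then have "\<eta> * x \<le> \<eta> * x\<^sup>2" "\<eta> ^ 5 * x \<le> \<eta> ^ 5 * x\<^sup>2"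
      using \<eta> by (simp_all add: mult_left_mono)
    then have x2: "2 \<le> \<eta> * x\<^sup>2" "4096 \<le> \<eta> ^ 5 * x\<^sup>2"
      using x by linarith+
    \<comment> \<open>Scales: \<open>K\<close> rows of order \<open>sqrt n\<close>, \<open>r\<close>
      rightmost visits per row of order \<open>n powr (1 / 4)\<close>, and half of the time for
      reaching the rows.\<close>
    define K r h where "K = nat \<lfloor>\<eta> * x\<^sup>2\<rfloor>" and "r = nat \<lfloor>\<eta> * x\<rfloor>" and "h = n div 2"
    have K: "real K \<le> \<eta> * x\<^sup>2" "\<eta> * x\<^sup>2 / 2 \<le> real K"
      using x2(1) unfolding K_def by linarith+
    have r: "real r \<le> \<eta> * x" "\<eta> * x / 2 \<le> real r"
      using x(2) unfolding r_def by linarith+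
    have h: "h < n" "real n / 2 \<le> real (Suc h)" "real n / 2 \<le> real (n - h)"
      using \<open>0 < n\<close> unfolding h_def by linarith+
    have "pr n (\<lambda>xs. 2 * real (card {m. m < n \<and> rightmost (take m xs)}) < real K * real r) \<le> 2 * (18 * \<eta>)"
    proof (rule pr_few_rightmost)
      show "0 < K" using K(2) x2(1) by (intro gr0I) auto
      fix k assume "k < K"
      then have k: "real k \<le> \<eta> * x\<^sup>2" using K(1) by linarith
      \<comment> \<open>\<open>sqrt 8\<close> is rounded up to 3, and at least \<open>n / 2\<close>
        time remains after \<open>h\<close>.\<close>
      have "real r * (sqrt 8 * real n powr (3 / 4)) / real (n - h)
          \<le> (\<eta> * x) * (3 * x ^ 3) / (x ^ 4 / 2)"
        unfolding n(3) by (intro frac_le mult_mono) (use r h(3) n x \<eta> in \<open>auto intro: real_le_lsqrt\<close>)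
      also have "\<dots> = 6 * \<eta>" using x by (simp add: field_simps eval_nat_numeral)
      finally have 1: "real r * (sqrt 8 * real n powr (3 / 4)) / real (n - h) \<le> 6 * \<eta>" .
      \<comment> \<open>The number 2/3 is a rational lower bound for
        \<open>1 / sqrt 2\<close>.\<close>
      have "x\<^sup>2 * (2 / 3) = sqrt ((x\<^sup>2 * (2 / 3))\<^sup>2)" by simp
      also have "\<dots> \<le> sqrt (real (Suc h))"
      proof (rule real_sqrt_le_mono)
        have "(x\<^sup>2 * (2 / 3))\<^sup>2 = x ^ 4 * (4 / 9)" by (simp add: power_mult_distrib power_divide flip: power_mult)
        also have "\<dots> \<le> x ^ 4 / 2" by simp
        finally show "(x\<^sup>2 * (2 / 3))\<^sup>2 \<le> real (Suc h)" using h(2) n(1) by simp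
      qed
      finally have "8 * real k / sqrt (real (Suc h)) \<le> 8 * (\<eta> * x\<^sup>2) / (x\<^sup>2 * (2 / 3))"
        by (intro frac_le mult_left_mono k) (use x \<eta> in auto)
      also have "\<dots> = 12 * \<eta>" using x by (simp add: field_simps)
      finally have 2: "8 * real k / sqrt (real (Suc h)) \<le> 12 * \<eta>" .
      show "pr n (\<lambda>xs. card {m. m < n \<and> row_rightmost (int k) (take m xs)} \<le> r) \<le> 18 * \<eta>"
        by (rule order_trans[OF pr_few_row_rightmost[OF h(1)] order_trans[OF add_mono[OF 1 2]]]) simp
    qed
    moreover define c where "c = \<eta>\<^sup>2 / 64 * x ^ 3"
    have "c > 0" using x \<eta> by (simp add: c_def)
    have "pr n (\<lambda>xs. c \<le> \<bar>right_martingale xs\<bar>) \<le> real n / c\<^sup>2"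
      by (rule pr_right_martingale) fact
    moreover have "real n / c\<^sup>2 \<le> \<eta>"
    proof -
      have "real n * 4096 \<le> x ^ 4 * (\<eta> ^ 5 * x\<^sup>2)" unfolding n(1) using x2 x by (intro mult_left_mono) auto
      also have "\<dots> = \<eta> * c\<^sup>2 * 4096" by (simp add: c_def power2_eq_square eval_nat_numeral)
      finally show ?thesis using \<open>c > 0\<close> by (simp add: field_simps)
    qed
    moreover have "pr n (\<lambda>xs. real (right_extensions xs) < c)
      \<le> pr n (\<lambda>xs. 2 * real (card {m. m < n \<and> rightmost (take m xs)}) < real K * real r
          \<or> c \<le> \<bar>right_martingale xs\<bar>)"
    proof (rule pr_mono)
      fix xs assume xs: "xs \<in> paths n" and few: "real (right_extensions xs) < c"
      \<comment> \<open>If there are at least \<open>K * r / 2\<close>, hence \<open>8 * c\<close>,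
        rightmost visits, a quarter of them is \<open>2 * c\<close>; fewer than \<open>c\<close>
        right steps then mean a deviation of at least \<open>c\<close>.\<close>
      have "\<eta> * x\<^sup>2 / 2 * (\<eta> * x / 2) \<le> real K * real r"
        by (rule mult_mono) (use K r x \<eta> in auto)
      then have "16 * c \<le> real K * real r"
        by (simp add: c_def eval_nat_numeral mult_ac)
      then show "2 * real (card {m. m < n \<and> rightmost (take m xs)}) < real K * real r
          \<or> c \<le> \<bar>right_martingale xs\<bar>"
        using few unfolding right_martingale_eq[OF length_paths[OF xs]] length_paths[OF xs] by linarith
    qed
    ultimately show ?case
      using pr_disj_le[of n "\<lambda>xs. 2 * real (card {m. m < n \<and> rightmost (take m xs)}) < real K * real r"
          "\<lambda>xs. c \<le> \<bar>right_martingale xs\<bar>"]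
      unfolding c_def n(3) by linarith
  qed
qed

section \<open>Holes\<close>

lemma ray_site_1: "ray_site x e (Suc 0) = x + e"
  by (simp add: ray_site_def prod_eq_iff)

lemma update_holes_eq:
  assumes "open_ray x e \<inter> A \<noteq> {}"
  shows "first_hole x e A \<in> A" "x + e \<in> A \<Longrightarrow> first_hole x e A = x + e"
proof -
  let ?P = "\<lambda>a. a \<ge> 1 \<and> ray_site x e a \<in> A"
  have "\<exists>a. ?P a" using assms by (auto simp: open_ray_def)
  then have "?P (LEAST a. ?P a)" by (rule LeastI_ex)
  then show "first_hole x e A \<in> A" by (simp add: first_hole_def)
  assume "x + e \<in> A"
  then have "(LEAST a. ?P a) = 1"
    by (intro Least_equality) (auto simp: ray_site_1)
  then show "first_hole x e A = x + e" by (simp add: first_hole_def ray_site_1)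
qed

text \<open>With a hole on the ray, one hole is removed and one added, or nothing changes because
  the next site is itself the first hole. The number of holes thus never decreases.\<close>

lemma card_update_holes:
  assumes "finite A"
  shows "card (update_holes x e A) = card A + of_bool (open_ray x e \<inter> A = {})"
proof (cases "open_ray x e \<inter> A = {}")
  case True
  have "x + e \<in> open_ray x e"
    unfolding open_ray_def ray_site_1[symmetric] by force
  with True have "x + e \<notin> A" by blast
  with True assms show ?thesis by (simp add: update_holes_def)
next
  case False
  note hole = update_holes_eq[OF False]
  show ?thesis
  proof (cases "x + e \<in> A")
    case True
    with False hole show ?thesis by (simp add: update_holes_def insert_absorb)
  next
    case notin: False
    have "Suc (card (A - {first_hole x e A})) = card A"
      using assms hole(1) by (rule card_Suc_Diff1)
    with False notin assms show ?thesis by (simp add: update_holes_def del: card_Diff_insert)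
  qed
qed

text \<open>At such a time the ray to the right contains no visited site, so the step creates a
  hole. The statement is about a single trajectory and applies to every outcome, including the null
  set of irregular increments.\<close>

lemma card_holes_ge:
  fixes X :: "nat \<Rightarrow> int \<times> int" and H :: "nat \<Rightarrow> (int \<times> int) set"
  assumes H0: "H 0 = {X 0}"
    and HS: "\<And>n. H (Suc n) = update_holes (X n) (X (Suc n) - X n) (H n)"
  shows "card {m. m < n \<and> X (Suc m) - X m = (1, 0) \<and>
    (\<forall>i<m. snd (X i) = snd (X m) \<longrightarrow> fst (X i) \<le> fst (X m))} \<le> card (H n)"
proof (induction n)
  case (Suc n)
  let ?P = "\<lambda>m. X (Suc m) - X m = (1, 0) \<and> (\<forall>i<m. snd (X i) = snd (X m) \<longrightarrow> fst (X i) \<le> fst (X m))"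
  \<comment> \<open>Holes are visited sites. This also gives finiteness, without which
    \<open>card\<close> would default to 0.\<close>
  have sub: "H m \<subseteq> X ` {..m}" for m
  proof (induction m)
    case (Suc m)
    then show ?case unfolding HS by (auto simp: update_holes_def atMost_Suc split: if_splits)
  qed (simp add: H0)
  have fin: "finite (H n)" using sub[of n] by (rule finite_subset) simp
  have "open_ray (X n) (X (Suc n) - X n) \<inter> H n = {}" if P: "?P n"
  proof -
    have "X i \<notin> open_ray (X n) (1, 0)" if "i \<le> n" for i
    proof
      assume "X i \<in> open_ray (X n) (1, 0)"
      then obtain a :: nat where "1 \<le> a" "X i = (fst (X n) + int a, snd (X n))"
        by (auto simp: open_ray_def ray_site_def)
      then have a: "fst (X n) < fst (X i)" "snd (X i) = snd (X n)" by simp_all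
      then have "i \<noteq> n" by auto
      with that have "i < n" by simp
      with P a have "fst (X i) \<le> fst (X n)" by blast
      with a show False by simp
    qed
    then show ?thesis using sub[of n] P by auto
  qed
  then have "card (H n) + of_bool (?P n) \<le> card (H (Suc n))"
    unfolding HS card_update_holes[OF fin] by auto
  moreover have "{m. m < Suc n \<and> ?P m} = {m. m < n \<and> ?P m} \<union> (if ?P n then {n} else {})"
    by (auto simp: less_Suc_eq)
  then have "card {m. m < Suc n \<and> ?P m} \<le> card {m. m < n \<and> ?P m} + of_bool (?P n)"
    by simp
  ultimately show ?case using Suc by linarith
qed simp

section \<open>Transfer from finite paths to the probability space\<close>

context earthworm_process
begin

definition steps :: "nat \<Rightarrow> 'w \<Rightarrow> (int \<times> int) list" where
  "steps n \<omega> = map (\<lambda>i. X (Suc i) \<omega> - X i \<omega>) [0..<n]"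

lemma length_steps [simp]: "length (steps n \<omega>) = n"
  by (simp add: steps_def)

lemma nth_steps [simp]: "i < n \<Longrightarrow> steps n \<omega> ! i = X (Suc i) \<omega> - X i \<omega>"
  by (simp add: steps_def)

lemma sum_list_steps:
  assumes "\<omega> \<in> space M" "i \<le> n"
  shows "sum_list (take i (steps n \<omega>)) = X i \<omega>"
proof -
  have "take i (steps n \<omega>) = steps i \<omega>" using assms by (simp add: steps_def take_map)
  moreover have "sum_list (steps i \<omega>) = X i \<omega>"
    by (induction i) (simp_all add: steps_def walk_start[OF assms(1)] zero_prod_def)
  ultimately show ?thesis by simp
qed

lemma right_extensions_le_num_holes:
  assumes "\<omega> \<in> space M"
  shows "right_extensions (steps n \<omega>) \<le> num_holes H n \<omega>"
proof -
  have "right_extensions (steps n \<omega>) = card {m. m < n \<and> X (Suc m) \<omega> - X m \<omega> = (1, 0) \<and>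
    (\<forall>i<m. snd (X i \<omega>) = snd (X m \<omega>) \<longrightarrow> fst (X i \<omega>) \<le> fst (X m \<omega>))}"
    by (intro arg_cong[of _ _ card] Collect_cong)
       (auto simp: rightmost_take sum_list_steps[OF assms] simp del: diff_Pair)
  also have "\<dots> \<le> card (H n \<omega>)"
    by (rule card_holes_ge) (simp_all add: walk_start holes_start holes_step assms)
  finally show ?thesis by (simp add: num_holes_def)
qed

lemma measurable_step [measurable]:
  "(\<lambda>\<omega>. X (Suc n) \<omega> - X n \<omega>) \<in> measurable M (count_space UNIV)"
  using steps_indep by (auto simp: indep_vars_def)

lemma sets_steps_eq: "{\<omega> \<in> space M. steps n \<omega> = xs} \<in> sets M"
proof -
  have "steps n \<omega> = xs \<longleftrightarrow> length xs = n \<and> (\<forall>i<n. X (Suc i) \<omega> - X i \<omega> = xs ! i)" for \<omega>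
    by (auto simp: steps_def list_eq_iff_nth_eq)
  then show ?thesis by simp
qed

lemma sets_steps: "{\<omega> \<in> space M. P (steps n \<omega>)} \<in> sets M"
proof -
  have "{\<omega> \<in> space M. P (steps n \<omega>)} = (\<Union>xs\<in>Collect P. {\<omega> \<in> space M. steps n \<omega> = xs})"
    by auto
  also have "\<dots> \<in> sets M"
    \<comment> \<open>There are only countably many integer step lists, so every property of
      \<open>steps n\<close> is an event.\<close>
    by (intro sets.countable_UN'' sets_steps_eq) simp
  finally show ?thesis .
qed

lemma prob_step: "prob {\<omega> \<in> space M. X (Suc n) \<omega> - X n \<omega> = e} = of_bool (e \<in> unit_steps) / 4"
proof -
  have "prob {\<omega> \<in> space M. X (Suc n) \<omega> - X n \<omega> = e}
      = measure (distr M (count_space UNIV) (\<lambda>\<omega>. X (Suc n) \<omega> - X n \<omega>)) {e}"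
    by (subst measure_distr) (auto intro!: arg_cong[of _ _ prob])
  also have "\<dots> = pmf (pmf_of_set unit_steps) e"
    by (simp add: steps_uniform pmf.rep_eq)
  also have "\<dots> = of_bool (e \<in> unit_steps) / 4"
    by (subst pmf_of_set) (auto simp: unit_steps_def)
  finally show ?thesis .
qed

text \<open>Independence and uniformity give each path the same weight. The case
  \<open>n = 0\<close> is separate because the product rule asks for a nonempty index set.\<close>

lemma prob_steps_eq:
  assumes "xs \<in> paths n"
  shows "prob {\<omega> \<in> space M. steps n \<omega> = xs} = 1 / 4 ^ n"
proof (cases "n = 0")
  case True
  then show ?thesis using assms by (simp add: paths_def steps_def prob_space)
next
  case False
  have "prob (\<Inter>i\<in>{..<n}. (\<lambda>\<omega>. X (Suc i) \<omega> - X i \<omega>) -` {xs ! i} \<inter> space M)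
      = (\<Prod>i<n. prob ((\<lambda>\<omega>. X (Suc i) \<omega> - X i \<omega>) -` {xs ! i} \<inter> space M))"
    by (rule indep_varsD[OF steps_indep]) (use False in auto)
  also have "\<dots> = (\<Prod>i<n. 1 / 4)"
  proof (rule prod.cong[OF refl])
    fix i assume "i \<in> {..<n}"
    then have "xs ! i \<in> unit_steps" using assms by (auto simp: paths_def)
    then show "prob ((\<lambda>\<omega>. X (Suc i) \<omega> - X i \<omega>) -` {xs ! i} \<inter> space M) = 1 / 4"
      using prob_step[of i "xs ! i"] by (simp add: vimage_def Int_def conj_commute)
  qed
  also have "(\<Inter>i\<in>{..<n}. (\<lambda>\<omega>. X (Suc i) \<omega> - X i \<omega>) -` {xs ! i} \<inter> space M)
      = {\<omega> \<in> space M. steps n \<omega> = xs}"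
    using False assms by (auto simp: steps_def list_eq_iff_nth_eq length_paths)
  finally show ?thesis by (simp add: power_one_over)
qed

text \<open>Outcomes whose step list lies outside \<open>paths n\<close> are dropped from the event,
  hence the inequality; it is the direction used for the lower bound.\<close>

lemma pr_le_prob_steps: "pr n P \<le> prob {\<omega> \<in> space M. P (steps n \<omega>)}"
proof -
  have "pr n P = (\<Sum>xs\<in>{xs \<in> paths n. P xs}. 1 / 4 ^ n)"
    by (simp add: avg_def sum_of_bool_eq Int_def)
  also have "\<dots> = (\<Sum>xs\<in>{xs \<in> paths n. P xs}. prob {\<omega> \<in> space M. steps n \<omega> = xs})"
    by (rule sum.cong) (auto simp: prob_steps_eq)
  also have "\<dots> = prob (\<Union>xs\<in>{xs \<in> paths n. P xs}. {\<omega> \<in> space M. steps n \<omega> = xs})"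
    by (rule finite_measure_finite_Union[symmetric])
       (auto simp: disjoint_family_on_def sets_steps_eq)
  also have "\<dots> \<le> prob {\<omega> \<in> space M. P (steps n \<omega>)}"
    by (rule finite_measure_mono) (auto simp: sets_steps)
  finally show ?thesis .
qed

text \<open>Measurability of the holes is derived: \<open>H n\<close> is determined by the first
  \<open>n\<close> steps.\<close>

lemma sets_num_holes: "{\<omega> \<in> space M. Q (num_holes H n \<omega>)} \<in> sets M"
proof -
  have det: "H n \<omega> = H n \<omega>'" if "steps n \<omega> = steps n \<omega>'" "\<omega> \<in> space M" "\<omega>' \<in> space M" for \<omega> \<omega>'
  proof -
    have X: "X i \<omega> = X i \<omega>'" if "i \<le> n" for i
      using sum_list_steps[of \<omega> i n] sum_list_steps[of \<omega>' i n] that \<open>steps n \<omega> = steps n \<omega>'\<close>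
        \<open>\<omega> \<in> space M\<close> \<open>\<omega>' \<in> space M\<close> by simp
    have "i \<le> n \<Longrightarrow> H i \<omega> = H i \<omega>'" for i
      by (induction i) (simp_all add: X holes_start holes_step that)
    then show ?thesis by simp
  qed
  \<comment> \<open>Quantifying over outcomes with the same steps expresses the event as a property
    of the step list.\<close>
  have "{\<omega> \<in> space M. Q (num_holes H n \<omega>)}
      = {\<omega> \<in> space M. \<exists>\<omega>'\<in>space M. steps n \<omega>' = steps n \<omega> \<and> Q (num_holes H n \<omega>')}"
    unfolding num_holes_def by (intro Collect_cong conj_cong refl) (metis det)
  also have "\<dots> \<in> sets M"
    by (rule sets_steps[of "\<lambda>xs. \<exists>\<omega>'\<in>space M. steps n \<omega>' = xs \<and> Q (num_holes H n \<omega>')"])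
  finally show ?thesis .
qed

end

theorem theorem2p1:
  fixes M :: "'w measure"
    and X :: "nat \<Rightarrow> 'w \<Rightarrow> int \<times> int"
    and H :: "nat \<Rightarrow> 'w \<Rightarrow> (int \<times> int) set"
  assumes "earthworm_process M X H"
  shows "\<forall>\<epsilon>::real. \<epsilon> > 0 \<longrightarrow>
    (\<exists>\<delta>::real. \<delta> > 0 \<and>
      liminf (\<lambda>n. ereal (measure M
        {\<omega> \<in> space M. real (num_holes H n \<omega>) \<ge> \<delta> * real n powr (3 / 4)}))
      \<ge> ereal (1 - \<epsilon>))"
proof (intro allI impI)
  interpret earthworm_process M X H by (rule assms)
  fix \<epsilon> :: real assume "\<epsilon> > 0"
  \<comment> \<open>The value comes from \<open>pr_few_extensions\<close> with \<eta> equal to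
    \<epsilon> / 37, whose error is then exactly \<epsilon>.\<close>
  define \<delta> where "\<delta> = (\<epsilon> / 37)\<^sup>2 / 64"
  have "\<forall>\<^sub>F n in sequentially. pr n (\<lambda>xs. real (right_extensions xs) < \<delta> * real n powr (3 / 4)) \<le> \<epsilon>"
    using pr_few_extensions[of "\<epsilon> / 37"] \<open>\<epsilon> > 0\<close> by (simp add: \<delta>_def)
  then have "\<forall>\<^sub>F n in sequentially. ereal (1 - \<epsilon>) \<le> ereal (prob
      {\<omega> \<in> space M. real (num_holes H n \<omega>) \<ge> \<delta> * real n powr (3 / 4)})"
  proof eventually_elim
    case (elim n)
    then have "1 - \<epsilon> \<le> pr n (\<lambda>xs. \<not> real (right_extensions xs) < \<delta> * real n powr (3 / 4))"
      unfolding pr_not by simp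
    also have "\<dots> \<le> prob {\<omega> \<in> space M. \<not> real (right_extensions (steps n \<omega>)) < \<delta> * real n powr (3 / 4)}"
      by (rule pr_le_prob_steps)
    also have "\<dots> \<le> prob {\<omega> \<in> space M. real (num_holes H n \<omega>) \<ge> \<delta> * real n powr (3 / 4)}"
    proof (rule finite_measure_mono)
      show "{\<omega> \<in> space M. \<not> real (right_extensions (steps n \<omega>)) < \<delta> * real n powr (3 / 4)}
        \<subseteq> {\<omega> \<in> space M. real (num_holes H n \<omega>) \<ge> \<delta> * real n powr (3 / 4)}"
        using right_extensions_le_num_holes[of _ n] by (fastforce simp del: length_steps)
    qed (rule sets_num_holes)
    finally show ?case by simp
  qed
  then have "ereal (1 - \<epsilon>) \<le> liminf (\<lambda>n. ereal (prob
      {\<omega> \<in> space M. real (num_holes H n \<omega>) \<ge> \<delta> * real n powr (3 / 4)}))"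
    by (rule Liminf_bounded)
  moreover have "\<delta> > 0" using \<open>\<epsilon> > 0\<close> by (simp add: \<delta>_def)
  ultimately show "\<exists>\<delta>>0. ereal (1 - \<epsilon>) \<le> liminf (\<lambda>n. ereal (prob
      {\<omega> \<in> space M. real (num_holes H n \<omega>) \<ge> \<delta> * real n powr (3 / 4)}))"
    by blast
qed

end
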